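(* Let $\mathcal L\subseteq\mathbb R$ be the set of all Mahler measures $m(F)$, where $F$ runs over all nonzero polynomials with integer coefficients in any number of variables. For $n\ge 1$ let $$F^{(n)}(z_1,\dots,z_{2n})=z_1+z_3+\cdots+z_{2n-1}-(z_2+z_4+\cdots+z_{2n}).$$ Then $\mathcal L=\bigcup_{n=1}^\infty \mathcal M(F^{(n)})$. Furthermore, $$\mathcal M(F^{(1)})\subseteq\mathcal M(F^{(2)})\subseteq\mathcal M(F^{(3)})\subseteq\cdots\subseteq\mathcal M(F^{(n)})\subseteq\cdots.$$
   Context: For a nonzero complex Laurent polynomial $G$ in $\ell\ge 0$ variables, its (logarithmic) Mahler measure is $$m(G)=\int_0^1\cdots\int_0^1\log|G(e^{2\pi i t_1},\dots,e^{2\pi i t_\ell})|\,dt_1\cdots dt_\ell,$$ so $m(G)=\log|G|$ when $\ell=0$ ($G$ a nonzero constant). For a Laurent polynomial $F$ in $k$ variables, $\ell\ge 0$ and $A=(a_{ij})\in\mathbb Z^{\ell\times k}$, put $$(z_1,\dots,z_\ell)^A=(z_1^{a_{11}}\cdots z_\ell^{a_{\ell 1}},\ \dots,\ z_1^{a_{1k}}\cdots z_\ell^{a_{\ell k}}),$$ a $k$-tuple of monomials (equal to $(1,\dots,1)$ when $\ell=0$), and define $F_A(z_1,\dots,z_\ell)=F((z_1,\dots,z_\ell)^A)$. Define $$\mathcal M(F)=\{m(F_A) : A\in\mathbb Z^{\ell\times k},\ \ell\ge 0,\ F_A\neq 0\}.$$ *)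

theory Defs
  imports
    "HOL-Analysis.Analysis"
    "HOL-Library.Poly_Mapping"
    "Jordan_Normal_Form.Matrix"
begin

text \<open>Group-ring encoding: a key is a finitely supported integer exponent vector, and ring
  multiplication is convolution.  The variables are indexed from \<open>0\<close>, so index \<open>i\<close> stands for
  the variable usually called \<open>z\<close> with subscript \<open>i + 1\<close>.\<close>

type_synonym laurent = "(nat \<Rightarrow>\<^sub>0 int) \<Rightarrow>\<^sub>0 complex"

definition laurent_in_vars :: "nat \<Rightarrow> laurent \<Rightarrow> bool" where
  "laurent_in_vars l G \<longleftrightarrow> (\<forall>e \<in> Poly_Mapping.keys G. Poly_Mapping.keys e \<subseteq> {..<l})"

definition laurent_var :: "nat \<Rightarrow> laurent" where
  "laurent_var i = Poly_Mapping.single (Poly_Mapping.single i 1) 1"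

definition laurent_eval :: "laurent \<Rightarrow> (nat \<Rightarrow> complex) \<Rightarrow> complex" where
  "laurent_eval G z = (\<Sum>e \<in> Poly_Mapping.keys G.
     Poly_Mapping.lookup G e * (\<Prod>i \<in> Poly_Mapping.keys e. z i powi Poly_Mapping.lookup e i))"

text \<open>The integrand takes the value \<open>ln 0 = 0\<close> at the zeros of \<open>G\<close> on the torus, which form a null set
  when \<open>G\<close> is nonzero.  For \<open>l = 0\<close> the measure is a unit point mass.\<close>

definition mahler_measure :: "nat \<Rightarrow> laurent \<Rightarrow> real" where
  "mahler_measure l G =
     (LINT t : ({..<l} \<rightarrow>\<^sub>E {0..1}) | (\<Pi>\<^sub>M i\<in>{..<l}. (lborel :: real measure)).
        ln (cmod (laurent_eval G (\<lambda>i. exp (2 * of_real pi * \<i> * of_real (t i))))))"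

definition monomial_tuple :: "int mat \<Rightarrow> (nat \<Rightarrow> complex) \<Rightarrow> nat \<Rightarrow> complex" where
  "monomial_tuple A z j = (\<Prod>i < dim_row A. z i powi (A $$ (i, j)))"

text \<open>\<open>F\<close> with its variables replaced by the monomials whose exponents are the columns of \<open>A\<close>,
  as a formal Laurent polynomial: the monomial with exponent vector \<open>e\<close> becomes the one with
  exponent vector \<open>A e\<close>, and colliding terms are added up.\<close>

definition laurent_subst :: "laurent \<Rightarrow> int mat \<Rightarrow> laurent" where
  "laurent_subst F A = (\<Sum>e \<in> Poly_Mapping.keys F.
     Poly_Mapping.single
       (\<Sum>i < dim_row A. Poly_Mapping.single i
          (\<Sum>j < dim_col A. A $$ (i, j) * Poly_Mapping.lookup e j))
       (Poly_Mapping.lookup F e))"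

lemma laurent_eval_superset:
  assumes "finite S" "Poly_Mapping.keys G \<subseteq> S"
  shows "laurent_eval G z = (\<Sum>e \<in> S.
     Poly_Mapping.lookup G e * (\<Prod>i \<in> Poly_Mapping.keys e. z i powi Poly_Mapping.lookup e i))"
  unfolding laurent_eval_def
  by (rule sum.mono_neutral_left) (use assms in \<open>auto simp: in_keys_iff\<close>)

lemma laurent_eval_add: "laurent_eval (F + G) z = laurent_eval F z + laurent_eval G z"
proof -
  let ?S = "Poly_Mapping.keys F \<union> Poly_Mapping.keys G"
  have "Poly_Mapping.keys (F + G) \<subseteq> ?S" by (rule Poly_Mapping.keys_add)
  then show ?thesis
    by (simp add: laurent_eval_superset[of ?S] lookup_add sum.distrib algebra_simps)
qed

lemma laurent_eval_zero [simp]: "laurent_eval 0 z = 0"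
  by (simp add: laurent_eval_def)

lemma laurent_eval_sum: "laurent_eval (sum f S) z = (\<Sum>x\<in>S. laurent_eval (f x) z)"
  by (induction S rule: infinite_finite_induct) (auto simp: laurent_eval_add)

lemma laurent_eval_single:
  "laurent_eval (Poly_Mapping.single e c) z =
     c * (\<Prod>i \<in> Poly_Mapping.keys e. z i powi Poly_Mapping.lookup e i)"
  by (simp add: laurent_eval_superset[of "{e}"])

lemma powi_sum: "x \<noteq> (0::complex) \<Longrightarrow> x powi (sum f S) = (\<Prod>j\<in>S. x powi f j)"
  by (induction S rule: infinite_finite_induct) (auto simp: power_int_add)

lemma powi_prod: "(\<Prod>j\<in>S. f j) powi n = (\<Prod>j\<in>S. (f j :: complex) powi n)"
  by (induction S rule: infinite_finite_induct) (auto simp: power_int_mult_distrib)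

lemma laurent_eval_subst:
  assumes F: "laurent_in_vars (dim_col A) F" and z: "\<And>i. z i \<noteq> 0"
  shows "laurent_eval (laurent_subst F A) z = laurent_eval F (monomial_tuple A z)"
proof -
  have "(\<Prod>i\<in>Poly_Mapping.keys e'. z i powi Poly_Mapping.lookup e' i)
      = (\<Prod>j\<in>Poly_Mapping.keys e. monomial_tuple A z j powi Poly_Mapping.lookup e j)"
    if e: "e \<in> Poly_Mapping.keys F"
      and e': "e' = (\<Sum>i < dim_row A. Poly_Mapping.single i
          (\<Sum>j < dim_col A. A $$ (i, j) * Poly_Mapping.lookup e j))" for e e'
  proof -
    have lk: "Poly_Mapping.lookup e' i = (if i < dim_row A then
       (\<Sum>j < dim_col A. A $$ (i, j) * Poly_Mapping.lookup e j) else 0)" for i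
      by (simp add: e' lookup_sum lookup_single when_def)
    have "(\<Prod>i\<in>Poly_Mapping.keys e'. z i powi Poly_Mapping.lookup e' i)
        = (\<Prod>i<dim_row A. z i powi Poly_Mapping.lookup e' i)"
      by (rule prod.mono_neutral_left) (auto simp: in_keys_iff lk split: if_splits)
    also have "\<dots> = (\<Prod>i<dim_row A. \<Prod>j<dim_col A.
        (z i powi (A $$ (i, j))) powi Poly_Mapping.lookup e j)"
      by (simp add: lk powi_sum z power_int_mult)
    also have "\<dots> = (\<Prod>j<dim_col A. monomial_tuple A z j powi Poly_Mapping.lookup e j)"
      by (subst prod.swap) (simp add: monomial_tuple_def powi_prod)
    also have "\<dots> = (\<Prod>j\<in>Poly_Mapping.keys e. monomial_tuple A z j powi Poly_Mapping.lookup e j)"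
      by (rule prod.mono_neutral_right)
         (use F e in \<open>auto simp: in_keys_iff laurent_in_vars_def\<close>)
    finally show ?thesis .
  qed
  then show ?thesis
    by (simp add: laurent_subst_def laurent_eval_sum laurent_eval_single laurent_eval_def[of F])
qed

definition mahler_set :: "nat \<Rightarrow> laurent \<Rightarrow> real set" where
  "mahler_set k F = {mahler_measure l (laurent_subst F A) | l A.
     A \<in> carrier_mat l k \<and> laurent_subst F A \<noteq> 0}"

definition integer_polynomial :: "laurent \<Rightarrow> bool" where
  "integer_polynomial F \<longleftrightarrow> (\<forall>e \<in> Poly_Mapping.keys F.
     Poly_Mapping.lookup F e \<in> \<int> \<and> (\<forall>i. Poly_Mapping.lookup e i \<ge> 0))"

definition integer_mahler_measures :: "real set" where
  "integer_mahler_measures = {mahler_measure l F | l F.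
     laurent_in_vars l F \<and> integer_polynomial F \<and> F \<noteq> 0}"

definition alternating_form :: "nat \<Rightarrow> laurent" where
  "alternating_form n = (\<Sum>j<n. laurent_var (2 * j)) - (\<Sum>j<n. laurent_var (2 * j + 1))"

end

theory Submission
  imports Defs "HOL-Real_Asymp.Real_Asymp"
begin

text \<open>A substitution into the \<open>n\<close>-th alternating form is the same thing as a sum of \<open>n\<close> differences
  of two Laurent monomials; multiplying it by a monomial turns it into an integer polynomial without
  changing its absolute value on the torus.  Conversely, an integer polynomial \<open>F\<close> need not vanish at
  \<open>(1, \<dots>, 1)\<close>, as every such sum does, but \<open>(z - 1) F\<close> with a new variable \<open>z\<close> does: each signed
  monomial of \<open>F\<close> contributes one difference of monomials.  The Mahler measure is unchanged because
  \<open>m(z - 1) = \<integral> ln (2 sin \<pi>s) ds = 0\<close>.\<close>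

section \<open>Expanding polynomials and exponent vectors into single terms\<close>

lemma poly_mapping_eq_sum_single:
  "(\<Sum>e\<in>Poly_Mapping.keys F. Poly_Mapping.single e (Poly_Mapping.lookup F e)) = F"
  by (rule poly_mapping_eqI) (auto simp: lookup_sum lookup_single when_def in_keys_iff)

lemma exponent_eq_sum_single:
  fixes e :: "nat \<Rightarrow>\<^sub>0 int"
  assumes "Poly_Mapping.keys e \<subseteq> {..<l}"
  shows "(\<Sum>i<l. Poly_Mapping.single i (Poly_Mapping.lookup e i)) = e"
  by (rule poly_mapping_eqI) (use assms in \<open>auto simp: lookup_sum lookup_single when_def in_keys_iff\<close>)

lemma keys_sum_single_subset:
  fixes f :: "nat \<Rightarrow> int"
  shows "Poly_Mapping.keys (\<Sum>i<l. Poly_Mapping.single i (f i)) \<subseteq> {..<l}"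
proof -
  have "Poly_Mapping.lookup (\<Sum>i<l. Poly_Mapping.single i (f i)) j = (if j < l then f j else 0)" for j
    by (simp add: lookup_sum lookup_single when_def)
  then show ?thesis by (auto simp: in_keys_iff split: if_splits)
qed

section \<open>Substitutions into the alternating forms\<close>

definition exponent_column :: "int mat \<Rightarrow> nat \<Rightarrow> nat \<Rightarrow>\<^sub>0 int" where
  "exponent_column A j = (\<Sum>i<dim_row A. Poly_Mapping.single i (A $$ (i, j)))"

text \<open>A common finite index set for two polynomials makes additivity of the substitution a
  termwise matter; the padding terms have coefficient 0.\<close>

lemma laurent_subst_superset:
  assumes "finite S" "Poly_Mapping.keys F \<subseteq> S"
  shows "laurent_subst F A = (\<Sum>e \<in> S.
     Poly_Mapping.single
       (\<Sum>i < dim_row A. Poly_Mapping.single i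
          (\<Sum>j < dim_col A. A $$ (i, j) * Poly_Mapping.lookup e j))
       (Poly_Mapping.lookup F e))"
  unfolding laurent_subst_def
  by (rule sum.mono_neutral_left) (use assms in \<open>auto simp: in_keys_iff\<close>)

lemma laurent_subst_add: "laurent_subst (F + G) A = laurent_subst F A + laurent_subst G A"
proof -
  let ?S = "Poly_Mapping.keys F \<union> Poly_Mapping.keys G"
  have "Poly_Mapping.keys (F + G) \<subseteq> ?S" by (rule Poly_Mapping.keys_add)
  then show ?thesis
    by (simp add: laurent_subst_superset[of ?S] lookup_add single_add sum.distrib)
qed

lemma laurent_subst_0: "laurent_subst 0 A = 0"
  by (simp add: laurent_subst_def)

lemma laurent_subst_diff: "laurent_subst (F - G) A = laurent_subst F A - laurent_subst G A"
  using laurent_subst_add[of "F - G" G A] by simp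

lemma laurent_subst_sum: "laurent_subst (sum f S) A = (\<Sum>x\<in>S. laurent_subst (f x) A)"
  by (induction S rule: infinite_finite_induct) (auto simp: laurent_subst_add laurent_subst_0)

lemma laurent_subst_var:
  assumes "k < dim_col A"
  shows "laurent_subst (laurent_var k) A = Poly_Mapping.single (exponent_column A k) 1"
proof -
  have "(\<Sum>j<dim_col A. A $$ (i, j) * Poly_Mapping.lookup (Poly_Mapping.single k 1) j) = A $$ (i, k)" for i
    using assms by (simp add: lookup_single when_def if_distrib cong: if_cong)
  then show ?thesis
    by (simp add: laurent_subst_def laurent_var_def exponent_column_def)
qed

text \<open>Monomials may repeat, which is how integer coefficients other than 1 and -1
  arise.\<close>

definition monomial_differences :: "nat \<Rightarrow> (nat \<Rightarrow> nat \<Rightarrow>\<^sub>0 int) \<Rightarrow> (nat \<Rightarrow> nat \<Rightarrow>\<^sub>0 int) \<Rightarrow> laurent" where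
  "monomial_differences n p q =
     (\<Sum>j<n. Poly_Mapping.single (p j) 1 - Poly_Mapping.single (q j) 1)"

lemma laurent_subst_alternating_form:
  assumes "dim_col A = 2 * n"
  shows "laurent_subst (alternating_form n) A =
    monomial_differences n (\<lambda>j. exponent_column A (2 * j)) (\<lambda>j. exponent_column A (2 * j + 1))"
  using assms
  by (simp add: alternating_form_def laurent_subst_diff laurent_subst_sum laurent_subst_var
      monomial_differences_def sum_subtractf)

text \<open>Even columns of the matrix are the exponents of the positive monomials and odd columns
  those of the negative ones, so choosing a matrix amounts to choosing \<open>p\<close> and
  \<open>q\<close>. The later arguments work with \<open>p\<close> and \<open>q\<close>
  only.\<close>

lemma mahler_set_alternating_form:
  "mahler_set (2 * n) (alternating_form n) =
    {mahler_measure l (monomial_differences n p q) | l p q.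
      (\<forall>j. Poly_Mapping.keys (p j) \<subseteq> {..<l}) \<and> (\<forall>j. Poly_Mapping.keys (q j) \<subseteq> {..<l}) \<and>
      monomial_differences n p q \<noteq> 0}" (is "_ = ?R")
proof
  show "mahler_set (2 * n) (alternating_form n) \<subseteq> ?R"
  proof
    fix x assume "x \<in> mahler_set (2 * n) (alternating_form n)"
    then obtain l A where A: "A \<in> carrier_mat l (2 * n)"
      and ne: "laurent_subst (alternating_form n) A \<noteq> 0"
      and x: "x = mahler_measure l (laurent_subst (alternating_form n) A)"
      unfolding mahler_set_def by blast
    \<comment> \<open>Entries past the last column are unspecified, but the support stays below
      \<open>l\<close> because only rows below \<open>l\<close> contribute.\<close>
    have "Poly_Mapping.keys (exponent_column A j) \<subseteq> {..<l}" for j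
      using A keys_sum_single_subset[where l = l] by (auto simp: exponent_column_def)
    moreover have "dim_col A = 2 * n" using A by auto
    ultimately show "x \<in> ?R"
      using ne x laurent_subst_alternating_form by (auto; blast)
  qed
  show "?R \<subseteq> mahler_set (2 * n) (alternating_form n)"
  proof
    fix x assume "x \<in> ?R"
    then obtain l p q where p: "\<And>j. Poly_Mapping.keys (p j) \<subseteq> {..<l}"
      and q: "\<And>j. Poly_Mapping.keys (q j) \<subseteq> {..<l}"
      and ne: "monomial_differences n p q \<noteq> 0"
      and x: "x = mahler_measure l (monomial_differences n p q)"
      by blast
    \<comment> \<open>The two families are interleaved. Keeping only \<open>l\<close> coordinates
      loses nothing, by the support bounds.\<close>
    define A where "A = mat l (2 * n) (\<lambda>(i, k).
      Poly_Mapping.lookup (if even k then p (k div 2) else q (k div 2)) i)"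
    have dims: "dim_row A = l" "dim_col A = 2 * n" by (simp_all add: A_def)
    have "exponent_column A (2 * j) = p j" "exponent_column A (2 * j + 1) = q j" if "j < n" for j
      using that exponent_eq_sum_single[OF p, of j] exponent_eq_sum_single[OF q, of j]
      by (simp_all add: exponent_column_def A_def)
    then have "laurent_subst (alternating_form n) A = monomial_differences n p q"
      by (simp add: laurent_subst_alternating_form[OF dims(2)] monomial_differences_def)
    moreover have "A \<in> carrier_mat l (2 * n)" by (simp add: A_def)
    ultimately show "x \<in> mahler_set (2 * n) (alternating_form n)"
      unfolding mahler_set_def using ne x by (auto intro!: exI[of _ l] exI[of _ A])
  qed
qed

text \<open>The extra pair is taken to be 1 - 1, with both exponents 0. It is stored at index
  \<open>n\<close>, which the shorter sum does not read.\<close>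

lemma mahler_set_alternating_form_mono:
  "mahler_set (2 * n) (alternating_form n) \<subseteq> mahler_set (2 * (n + 1)) (alternating_form (n + 1))"
proof
  fix x assume "x \<in> mahler_set (2 * n) (alternating_form n)"
  then obtain l p q where p: "\<And>j. Poly_Mapping.keys (p j) \<subseteq> {..<l}"
    and q: "\<And>j. Poly_Mapping.keys (q j) \<subseteq> {..<l}"
    and ne: "monomial_differences n p q \<noteq> 0"
    and x: "x = mahler_measure l (monomial_differences n p q)"
    unfolding mahler_set_alternating_form by blast
  have "monomial_differences (n + 1) (p(n := 0)) (q(n := 0)) = monomial_differences n p q"
    by (simp add: monomial_differences_def)
  moreover have "Poly_Mapping.keys ((p(n := 0)) j) \<subseteq> {..<l}"
    "Poly_Mapping.keys ((q(n := 0)) j) \<subseteq> {..<l}" for j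
    using p q by auto
  ultimately show "x \<in> mahler_set (2 * (n + 1)) (alternating_form (n + 1))"
    unfolding mahler_set_alternating_form using ne x by (smt (verit) mem_Collect_eq)
qed

section \<open>Evaluation on the torus and clearing of negative exponents\<close>

lemma laurent_eval_mult_single:
  assumes z: "\<And>i. z i \<noteq> 0"
  shows "laurent_eval (Poly_Mapping.single a c * F) z =
    laurent_eval (Poly_Mapping.single a c) z * laurent_eval F z"
proof -
  have mon: "(\<Prod>i\<in>Poly_Mapping.keys (a + b). z i powi Poly_Mapping.lookup (a + b) i) =
     (\<Prod>i\<in>Poly_Mapping.keys a. z i powi Poly_Mapping.lookup a i) *
     (\<Prod>i\<in>Poly_Mapping.keys b. z i powi Poly_Mapping.lookup b i)" for b :: "nat \<Rightarrow>\<^sub>0 int"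
  proof -
    \<comment> \<open>Exponents may cancel in \<open>a + b\<close>, so its support can shrink. On
      the union of supports the added factors are zeroth powers, hence 1.\<close>
    let ?S = "Poly_Mapping.keys a \<union> Poly_Mapping.keys b"
    have ext: "(\<Prod>i\<in>Poly_Mapping.keys d. z i powi Poly_Mapping.lookup d i) =
        (\<Prod>i\<in>?S. z i powi Poly_Mapping.lookup d i)"
      if "Poly_Mapping.keys d \<subseteq> ?S" for d :: "nat \<Rightarrow>\<^sub>0 int"
      by (rule prod.mono_neutral_left) (use that in \<open>auto simp: in_keys_iff\<close>)
    show ?thesis
      unfolding ext[OF Poly_Mapping.keys_add] ext[OF Un_upper1] ext[OF Un_upper2]
      by (simp add: lookup_add power_int_add z prod.distrib)
  qed
  have "Poly_Mapping.single a c * F =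
      (\<Sum>e\<in>Poly_Mapping.keys F. Poly_Mapping.single (a + e) (c * Poly_Mapping.lookup F e))"
    by (subst poly_mapping_eq_sum_single[of F, symmetric]) (simp add: sum_distrib_left mult_single)
  then show ?thesis
    by (simp add: laurent_eval_sum laurent_eval_single mon laurent_eval_def[of F] sum_distrib_left mult_ac)
qed

lemma laurent_eval_cong:
  assumes "laurent_in_vars l F" "\<And>i. i < l \<Longrightarrow> z i = w i"
  shows "laurent_eval F z = laurent_eval F w"
proof -
  have "z i = w i" if "e \<in> Poly_Mapping.keys F" "i \<in> Poly_Mapping.keys e" for e i
    using assms that unfolding laurent_in_vars_def by blast
  then show ?thesis
    unfolding laurent_eval_def by (intro sum.cong prod.cong refl arg_cong2[where f = "(*)"]) simp
qed

lemma norm_laurent_eval_monomial: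
  assumes "\<And>i. cmod (z i) = 1"
  shows "cmod (laurent_eval (Poly_Mapping.single e 1) z) = 1"
  using assms by (simp add: laurent_eval_single norm_power_int flip: prod_norm)

lemma norm_circle: "cmod (exp (2 * of_real pi * \<i> * of_real s)) = 1"
  using norm_exp_i_times[of "2 * pi * s"] by (simp add: mult_ac)

text \<open>A monomial has absolute value 1 on the torus, so the two integrands agree at every
  point, zeros included.\<close>

lemma mahler_measure_monomial_mult:
  "mahler_measure l (Poly_Mapping.single e 1 * G) = mahler_measure l G"
  by (simp add: mahler_measure_def laurent_eval_mult_single norm_mult norm_laurent_eval_monomial norm_circle)

text \<open>A high power of the product of all variables clears the negative exponents, and
  coefficients that count monomials with sign are integers.\<close>

lemma monomial_differences_in_integer_mahler_measures:
  assumes p: "\<And>j. Poly_Mapping.keys (p j) \<subseteq> {..<l}"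
    and q: "\<And>j. Poly_Mapping.keys (q j) \<subseteq> {..<l}"
    and ne: "monomial_differences n p q \<noteq> 0"
  shows "mahler_measure l (monomial_differences n p q) \<in> integer_mahler_measures"
proof -
  \<comment> \<open>A crude common bound: \<open>N\<close> dominates the absolute value of every
    exponent, so adding \<open>N\<close> makes each one nonnegative.\<close>
  define N where "N = (\<Sum>j<n. \<Sum>i<l. \<bar>Poly_Mapping.lookup (p j) i\<bar> + \<bar>Poly_Mapping.lookup (q j) i\<bar>)"
  define m where "m = (\<Sum>i<l. Poly_Mapping.single i N)"
  define G where "G = Poly_Mapping.single m 1 * monomial_differences n p q"
  have m: "Poly_Mapping.keys m \<subseteq> {..<l}" "i < l \<Longrightarrow> Poly_Mapping.lookup m i = N" for i
    unfolding m_def by (rule keys_sum_single_subset) (simp add: lookup_sum lookup_single when_def)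
  have N: "\<bar>Poly_Mapping.lookup (p j) i\<bar> + \<bar>Poly_Mapping.lookup (q j) i\<bar> \<le> N" if "j < n" "i < l" for i j
  proof -
    have "\<bar>Poly_Mapping.lookup (p j) i\<bar> + \<bar>Poly_Mapping.lookup (q j) i\<bar>
        \<le> (\<Sum>i<l. \<bar>Poly_Mapping.lookup (p j) i\<bar> + \<bar>Poly_Mapping.lookup (q j) i\<bar>)"
      using that by (intro member_le_sum) auto
    also have "\<dots> \<le> N"
      unfolding N_def using that by (intro member_le_sum) (auto intro!: sum_nonneg)
    finally show ?thesis .
  qed
  have G_eq: "G = monomial_differences n (\<lambda>j. m + p j) (\<lambda>j. m + q j)"
    by (simp add: G_def monomial_differences_def sum_distrib_left right_diff_distrib mult_single)
  \<comment> \<open>How often \<open>e\<close> occurs as \<open>m + p j\<close>, minus how often as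
    \<open>m + q j\<close>. This yields integrality, and it vanishes at exponents of neither form,
    which locates the support.\<close>
  have lookup_G: "Poly_Mapping.lookup G e = of_int (\<Sum>j<n. (1 when m + p j = e) - (1 when m + q j = e))" for e
    by (auto simp: G_eq monomial_differences_def lookup_sum lookup_minus lookup_single when_def
        intro!: sum.cong)
  have e: "\<exists>j<n. e = m + p j \<or> e = m + q j" if "e \<in> Poly_Mapping.keys G" for e
  proof (rule ccontr)
    assume "\<not> ?thesis"
    then have "(\<Sum>j<n. (1 when m + p j = e) - (1 when m + q j = e)) = (0::int)"
      by (intro sum.neutral) (auto simp: when_def)
    with that show False unfolding in_keys_iff lookup_G by simp
  qed
  \<comment> \<open>Monomials are units, so \<open>G\<close> cannot vanish.\<close>
  have "Poly_Mapping.single (- m) 1 * G = monomial_differences n p q"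
    by (simp add: G_def mult_single single_one flip: mult.assoc)
  then have "G \<noteq> 0" using ne by auto
  moreover have "laurent_in_vars l G"
    unfolding laurent_in_vars_def
  proof
    fix d assume "d \<in> Poly_Mapping.keys G"
    from e[OF this] obtain j where "d = m + p j \<or> d = m + q j" by blast
    then have "Poly_Mapping.keys d \<subseteq>
        Poly_Mapping.keys m \<union> (Poly_Mapping.keys (p j) \<union> Poly_Mapping.keys (q j))"
      using Poly_Mapping.keys_add[of m "p j"] Poly_Mapping.keys_add[of m "q j"] by auto
    also have "\<dots> \<subseteq> {..<l}"
      using m(1) p q by simp
    finally show "Poly_Mapping.keys d \<subseteq> {..<l}" .
  qed
  moreover have "integer_polynomial G"
    unfolding integer_polynomial_def
  proof (intro ballI conjI allI)
    fix d assume d: "d \<in> Poly_Mapping.keys G"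
    show "Poly_Mapping.lookup G d \<in> \<int>" by (simp only: lookup_G Ints_of_int)
    fix i
    show "0 \<le> Poly_Mapping.lookup d i"
    proof (cases "i < l")
      case True
      from e[OF d] obtain j where "j < n" "d = m + p j \<or> d = m + q j" by blast
      with N[of j i] True m(2)[OF True] show ?thesis by (auto simp: lookup_add)
    next
      case False
      then have "i \<notin> Poly_Mapping.keys d"
        using \<open>laurent_in_vars l G\<close> d unfolding laurent_in_vars_def by blast
      then show ?thesis by (simp add: in_keys_iff)
    qed
  qed
  moreover have "mahler_measure l G = mahler_measure l (monomial_differences n p q)"
    unfolding G_def by (rule mahler_measure_monomial_mult)
  ultimately show ?thesis
    unfolding integer_mahler_measures_def by (metis (mono_tags, lifting) mem_Collect_eq)
qed

section \<open>The additive group of sums of monomial differences\<close>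

definition is_monomial_differences :: "nat \<Rightarrow> laurent \<Rightarrow> bool" where
  "is_monomial_differences l G \<longleftrightarrow> (\<exists>n p q. G = monomial_differences n p q \<and>
     (\<forall>j. Poly_Mapping.keys (p j) \<subseteq> {..<l}) \<and> (\<forall>j. Poly_Mapping.keys (q j) \<subseteq> {..<l}))"

lemma is_monomial_differences_single:
  assumes "Poly_Mapping.keys a \<subseteq> {..<l}" "Poly_Mapping.keys b \<subseteq> {..<l}"
  shows "is_monomial_differences l (Poly_Mapping.single a 1 - Poly_Mapping.single b 1)"
  unfolding is_monomial_differences_def
  by (rule exI[of _ 1], rule exI[of _ "\<lambda>_. a"], rule exI[of _ "\<lambda>_. b"])
    (use assms in \<open>simp add: monomial_differences_def\<close>)

lemma is_monomial_differences_0: "is_monomial_differences l 0"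
  unfolding is_monomial_differences_def
  by (rule exI[of _ 0], rule exI[of _ "\<lambda>_. 0"], rule exI[of _ "\<lambda>_. 0"])
    (simp add: monomial_differences_def)

lemma is_monomial_differences_uminus:
  assumes "is_monomial_differences l F"
  shows "is_monomial_differences l (- F)"
proof -
  have "- monomial_differences n p q = monomial_differences n q p" for n p q
    by (simp add: monomial_differences_def sum_negf[symmetric])
  with assms show ?thesis
    unfolding is_monomial_differences_def by metis
qed

lemma is_monomial_differences_add:
  assumes "is_monomial_differences l F" "is_monomial_differences l G"
  shows "is_monomial_differences l (F + G)"
proof -
  obtain n p q where F: "F = monomial_differences n p q"
    "\<forall>j. Poly_Mapping.keys (p j) \<subseteq> {..<l}" "\<forall>j. Poly_Mapping.keys (q j) \<subseteq> {..<l}"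
    using assms(1) unfolding is_monomial_differences_def by blast
  obtain n' p' q' where G: "G = monomial_differences n' p' q'"
    "\<forall>j. Poly_Mapping.keys (p' j) \<subseteq> {..<l}" "\<forall>j. Poly_Mapping.keys (q' j) \<subseteq> {..<l}"
    using assms(2) unfolding is_monomial_differences_def by blast
  \<comment> \<open>Concatenation of the two families, the second shifted by
    \<open>n\<close>.\<close>
  have "F + G = monomial_differences (n + n')
      (\<lambda>j. if j < n then p j else p' (j - n)) (\<lambda>j. if j < n then q j else q' (j - n))"
    unfolding F G monomial_differences_def by (induction n') (simp_all add: add_ac)
  with F G show ?thesis
    unfolding is_monomial_differences_def
    by (intro exI[of _ "n + n'"] exI[of _ "\<lambda>j. if j < n then p j else p' (j - n)"]
        exI[of _ "\<lambda>j. if j < n then q j else q' (j - n)"]) simp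
qed

text \<open>Closure under addition and negation gives all integer multiples, by induction from 0 in
  both directions.\<close>

lemma is_monomial_differences_of_int_mult:
  assumes "is_monomial_differences l F"
  shows "is_monomial_differences l (of_int c * F)"
proof (induction c rule: int_induct[of _ 0])
  case base
  then show ?case by (simp add: is_monomial_differences_0)
next
  case (step1 i)
  then show ?case
    using is_monomial_differences_add[OF _ assms] by (simp add: distrib_right)
next
  case (step2 i)
  then show ?case
    using is_monomial_differences_add[OF _ is_monomial_differences_uminus[OF assms], of "of_int i * F"]
    by (simp add: left_diff_distrib)
qed

lemma is_monomial_differences_sum:
  "(\<And>x. x \<in> S \<Longrightarrow> is_monomial_differences l (f x)) \<Longrightarrow> is_monomial_differences l (sum f S)"
  by (induction S rule: infinite_finite_induct)
    (auto intro: is_monomial_differences_0 is_monomial_differences_add)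

text \<open>With \<open>z\<close> the variable of index \<open>l\<close>, a term c M of
  \<open>F\<close> contributes c (z M - M), an integer multiple of one difference.\<close>

lemma is_monomial_differences_mult_var:
  assumes "laurent_in_vars l F" "\<And>e. e \<in> Poly_Mapping.keys F \<Longrightarrow> Poly_Mapping.lookup F e \<in> \<int>"
  shows "is_monomial_differences (Suc l) (laurent_var l * F - F)"
proof -
  let ?D = "\<lambda>e. Poly_Mapping.single (Poly_Mapping.single l 1 + e) 1 - Poly_Mapping.single e (1::complex)"
  \<comment> \<open>Writing the scalar as the constant polynomial \<open>single 0 c\<close> makes
    scaling a ring product; for integral c this is \<open>of_int c\<close>.\<close>
  have D: "Poly_Mapping.single (Poly_Mapping.single l 1 + e) c - Poly_Mapping.single e c =
     Poly_Mapping.single 0 c * ?D e" for e and c :: complex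
    by (simp add: right_diff_distrib mult_single)
  have "laurent_var l * F - F =
      (\<Sum>e\<in>Poly_Mapping.keys F. Poly_Mapping.single 0 (Poly_Mapping.lookup F e) * ?D e)"
    unfolding D[symmetric] sum_subtractf poly_mapping_eq_sum_single laurent_var_def
    by (subst poly_mapping_eq_sum_single[of F, symmetric], subst sum_distrib_left)
       (simp add: mult_single)
  moreover have "is_monomial_differences (Suc l) (Poly_Mapping.single 0 (Poly_Mapping.lookup F e) * ?D e)"
    if e: "e \<in> Poly_Mapping.keys F" for e
  proof -
    obtain c where c: "Poly_Mapping.lookup F e = of_int c"
      using assms(2)[OF e] by (auto elim: Ints_cases)
    have ke: "Poly_Mapping.keys e \<subseteq> {..<Suc l}"
      using assms(1) e unfolding laurent_in_vars_def by fastforce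
    then have "is_monomial_differences (Suc l) (?D e)"
      using Poly_Mapping.keys_add[of "Poly_Mapping.single l 1" e]
      by (intro is_monomial_differences_single) (auto split: if_splits)
    from is_monomial_differences_of_int_mult[OF this, of c] show ?thesis
      by (simp only: c single_of_int)
  qed
  ultimately show ?thesis by (simp add: is_monomial_differences_sum)
qed

text \<open>The new variable has exponent 1 throughout the first product and 0 throughout
  \<open>F\<close>, so no term of \<open>F\<close> is cancelled.\<close>

lemma mult_var_diff_nonzero:
  assumes F: "laurent_in_vars l F" and "F \<noteq> 0"
  shows "laurent_var l * F - F \<noteq> 0"
proof -
  obtain e where e: "e \<in> Poly_Mapping.keys F" using \<open>F \<noteq> 0\<close> by (metis keys_eq_empty ex_in_conv)
  have l0: "Poly_Mapping.lookup d l = 0" if "d \<in> Poly_Mapping.keys F" for d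
    using F that unfolding laurent_in_vars_def by (force simp: in_keys_iff)
  have "e \<notin> Poly_Mapping.keys (laurent_var l * F)"
  proof
    assume "e \<in> Poly_Mapping.keys (laurent_var l * F)"
    then obtain d where "d \<in> Poly_Mapping.keys F" "e = Poly_Mapping.single l 1 + d"
      using keys_mult[of "laurent_var l" F] by (auto simp: laurent_var_def)
    then show False using l0[OF e] l0[of d] by (simp add: lookup_add)
  qed
  then have "Poly_Mapping.lookup (laurent_var l * F - F) e \<noteq> 0"
    using e by (simp add: lookup_minus in_keys_iff)
  then show ?thesis by auto
qed

section \<open>The integral of ln (2 sin (pi s)) over the unit interval\<close>

lemma sin_pi_times_ge:
  fixes s :: real
  assumes "0 \<le> s" "s \<le> 1 / 2"
  shows "s \<le> sin (pi * s)"
proof -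
  \<comment> \<open>The half angle gives sin (2 u) = 2 sin u cos u >= 2 u (cos u)^2 >= u >= s, from
    u <= tan u, from (cos u)^2 >= 1/2 for u <= pi/4, and from pi >= 2.\<close>
  define u where "u = pi * s / 2"
  have u: "0 \<le> u" "u \<le> pi / 4"
    using assms by (simp_all add: u_def)
  have s2: "sin u \<le> sin (pi / 4)" "0 \<le> sin u"
    using u by (auto intro!: sin_monotone_2pi_le sin_ge_zero)
  have c: "cos u > 0"
    using u pi_gt_zero by (intro cos_gt_zero_pi) linarith+
  have "(sin u)\<^sup>2 \<le> (sin (pi / 4))\<^sup>2"
    using s2 by (intro power_mono)
  then have c2: "(cos u)\<^sup>2 \<ge> 1 / 2"
    by (simp add: sin_45 power_divide cos_squared_eq)
  have "tan u \<ge> 0"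
    using s2(2) c by (simp add: tan_def)
  then have "u \<le> tan u"
    using abs_tan_ge[of u] u pi_gt_zero by simp
  then have "u * cos u \<le> sin u"
    using c by (simp add: tan_def field_simps)
  then have "2 * (u * cos u) * cos u \<le> 2 * sin u * cos u"
    using c by (intro mult_right_mono) auto
  moreover have "2 * u * (1 / 2) \<le> 2 * u * (cos u)\<^sup>2"
    using c2 u by (intro mult_left_mono) auto
  ultimately have "u \<le> sin (2 * u)"
    using sin_double[of u] by (simp add: power2_eq_square mult_ac)
  moreover have "s \<le> u"
    using mult_right_mono[of 2 pi s] assms pi_ge_two by (simp add: u_def)
  ultimately show ?thesis by (simp add: u_def)
qed

text \<open>The sine is at least min s (1 - s), which is at least s (1 - s). This gives an
  integrable majorant with logarithmic singularities at both end points.\<close>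

lemma ln_sin_bound:
  fixes s :: real
  assumes "s \<in> {0..1}"
  shows "norm (ln (2 * sin (pi * s))) \<le> ln 2 - ln s - ln (1 - s)"
\<comment> \<open>At the end points the convention ln 0 = 0 reduces the bound to 0 <= ln 2.\<close>
proof (cases "s = 0 \<or> s = 1")
  case True
  then show ?thesis by auto
next
  case False
  with assms have s: "0 < s" "s < 1" by auto
  then have "pi * s < pi"
    using pi_gt_zero by (simp add: mult_less_cancel_left2 not_le)
  then have pos: "sin (pi * s) > 0"
    using s by (intro sin_gt_zero) auto
  \<comment> \<open>The sine is symmetric about 1/2, so the estimate on the half interval covers all
    of it.\<close>
  have "min s (1 - s) \<le> sin (pi * min s (1 - s))"
    using s by (intro sin_pi_times_ge) (auto simp: min_def)
  also have "sin (pi * min s (1 - s)) = sin (pi * s)"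
    by (simp add: min_def right_diff_distrib)
  finally have "min s (1 - s) \<le> sin (pi * s)" .
  then have "ln (min s (1 - s)) \<le> ln (2 * sin (pi * s))"
    using s pos by (intro ln_mono) auto
  moreover have "ln s + ln (1 - s) \<le> ln (min s (1 - s))"
    using s by (auto simp: min_def)
  moreover have "ln (2 * sin (pi * s)) \<le> ln 2"
    using pos by simp
  moreover have "ln s \<le> 0" "ln (1 - s) \<le> 0" "ln 2 \<ge> (0::real)"
    using s by auto
  ultimately show ?thesis unfolding real_norm_def abs_le_iff by linarith
qed

lemma integrable_ln_sin:
  "set_integrable lborel {0..1} (\<lambda>s::real. ln (2 * sin (pi * s)))"
proof -
  \<comment> \<open>The function s ln s is an antiderivative of ln s + 1 inside the interval. Its
    limit 0 at 0 agrees with the value given by ln 0 = 0, so it is continuous up to the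
    boundary.\<close>
  have cont: "continuous_on {0..1} (\<lambda>s::real. s * ln s)"
  proof -
    have "continuous (at s within {0..1}) (\<lambda>s::real. s * ln s)" if "s \<in> {0..1}" for s
    proof (cases "s = 0")
      case True
      have "((\<lambda>s::real. s * ln s) \<longlongrightarrow> 0) (at_right 0)"
        by real_asymp
      then show ?thesis
        using True by (simp add: continuous_within at_within_Icc_at_right)
    next
      case False
      then show ?thesis using that by (intro continuous_intros) auto
    qed
    then show ?thesis by (simp add: continuous_on_eq_continuous_within)
  qed
  have "((\<lambda>s::real. ln s + 1) has_integral 1 * ln 1 - 0 * ln 0) {0..1}"
    by (rule fundamental_theorem_of_calculus_interior[OF _ cont])
      (auto simp flip: has_real_derivative_iff_has_vector_derivative
        intro!: derivative_eq_intros)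
  from has_integral_diff[OF this has_integral_const_real[of 1 0 1]]
  have ln1: "(ln has_integral (- 1 :: real)) (cbox 0 1)"
    by simp
  from has_integral_affinity[OF this, of "-1" 1]
  have ln2: "((\<lambda>s::real. ln (1 - s)) has_integral - 1) {0..1}"
    by (simp add: image_diff_atLeastAtMost)
  have dom: "(\<lambda>s::real. ln 2 - ln s - ln (1 - s)) integrable_on {0..1}"
    using ln1 ln2 by (intro integrable_diff integrable_const_ivl) (auto simp: integrable_on_def)
  have m: "(\<lambda>s::real. ln (2 * sin (pi * s))) \<in> borel_measurable borel"
    by measurable
  \<comment> \<open>Domination gives integrability for the completed measure; Borel measurability
    then carries it to \<open>lborel\<close>.\<close>
  have "(\<lambda>s::real. ln (2 * sin (pi * s))) absolutely_integrable_on {0..1}"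
    by (rule measurable_bounded_by_integrable_imp_absolutely_integrable[OF _ _ dom])
      (use ln_sin_bound m in \<open>auto intro!: measurable_restrict_space1 measurable_completion\<close>)
  then show ?thesis
    unfolding set_integrable_def
    by (subst (asm) integrable_completion) (use m in measurable)
qed

text \<open>The angle-doubling formula for sine equates half of the integral with the whole
  of it, so it vanishes.\<close>

lemma integral_ln_sin: "(LINT s : {0..1} | lborel. ln (2 * sin (pi * s))) = (0::real)"
proof -
  let ?g = "\<lambda>s::real. ln (2 * sin (pi * s))"
  define I where "I = integral {0..1} ?g"
  define a where "a = integral {0..1/2} ?g"
  note int = set_borel_integral_eq_integral[OF integrable_ln_sin]
  have I: "(?g has_integral I) (cbox 0 1)"
    using int(1) by (simp add: I_def integrable_integral)
  have "?g integrable_on {0..1/2}"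
    by (rule integrable_on_subinterval[OF int(1)]) auto
  then have a: "(?g has_integral a) (cbox 0 (1/2))"
    by (simp add: a_def integrable_integral)
  \<comment> \<open>Reflection in 1/2 preserves the integrand, so both halves contribute
    \<open>a\<close>.\<close>
  from has_integral_affinity[OF a, of "-1" 1]
  have "((\<lambda>s. ?g (1 - s)) has_integral a) {1/2..1}"
    by (simp add: image_diff_atLeastAtMost)
  then have a2: "(?g has_integral a) {1/2..1}"
    by (simp add: right_diff_distrib)
  have "(?g has_integral a + a) {0..1}"
    using a a2 by (intro has_integral_combine[of 0 "1/2" 1]) auto
  then have Ia: "I = 2 * a"
    using has_integral_unique[of ?g I "{0..1}" "a + a"] I by simp
  have "((\<lambda>s. ?g (2 * s)) has_integral I / 2) (cbox 0 (1/2))"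
    using has_integral_affinity'[OF I, of 2 0] by simp
  moreover have "((\<lambda>s. ?g (s + 1/2)) has_integral a) (cbox 0 (1/2))"
    using has_integral_affinity'[of ?g a "1/2" 1 1 "1/2"] a2 by simp
  then have "((\<lambda>s. ?g s + ?g (s + 1/2)) has_integral a + a) (cbox 0 (1/2))"
    by (intro has_integral_add a)
  then have "((\<lambda>s. ?g (2 * s)) has_integral a + a) (cbox 0 (1/2))"
  \<comment> \<open>The identity fails at 0 and 1/2, where ln 0 = 0 gives 0 on one side and ln 2 on
    the other, so it is used in the interior only.\<close>
  proof (rule has_integral_spike_interior)
    fix s :: real assume "s \<in> box 0 (1/2)"
    then have s: "0 < s" "s < 1/2" by auto
    have "0 < pi * s" "pi * s < pi / 2"
      using s mult_strict_left_mono[of s "1/2" pi] by simp_all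
    then have "sin (pi * s) > 0" "cos (pi * s) > 0"
      by (auto intro!: sin_gt_zero cos_gt_zero)
    moreover have "sin (pi * (2 * s)) = 2 * sin (pi * s) * cos (pi * s)"
      using sin_double[of "pi * s"] by (simp add: mult_ac)
    moreover have "sin (pi * (s + 1/2)) = cos (pi * s)"
      by (simp add: distrib_left sin_add)
    moreover have "ln (2 * sin (pi * s) * (2 * cos (pi * s))) = ln (2 * sin (pi * s)) + ln (2 * cos (pi * s))"
      using calculation(1,2) by (intro ln_mult_pos) auto
    ultimately show "?g (2 * s) = ?g s + ?g (s + 1/2)"
      by (simp add: mult_ac)
  qed
  ultimately have "I / 2 = a + a"
    using has_integral_unique by blast
  with Ia have "I = 0" by simp
  then show ?thesis using int(2) by (simp add: I_def)
qed

text \<open>A chord of the unit circle has length twice the absolute sine of half its angle, and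
  that sine is nonnegative here.\<close>

lemma norm_circle_minus_1:
  assumes "s \<in> {0..1}"
  shows "cmod (exp (2 * of_real pi * \<i> * of_real s) - 1) = 2 * sin (pi * s)"
proof -
  have "exp (2 * of_real pi * \<i> * of_real s) = exp (\<i> * of_real (2 * pi * s))"
    by (simp add: mult_ac)
  moreover have "sin (pi * s) \<ge> 0"
    using assms by (intro sin_ge_zero) (auto simp: mult_le_cancel_left1)
  ultimately show ?thesis
    using dist_exp_i_1[of "2 * pi * s"] by simp
qed

section \<open>Product integrals and splitting off one coordinate\<close>

lemma (in pair_sigma_finite) integrable_product:
  fixes f g :: "_ \<Rightarrow> real"
  assumes "integrable M1 f" "integrable M2 g"
  shows "integrable (M1 \<Otimes>\<^sub>M M2) (\<lambda>(x, y). f x * g y)"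
proof (rule Fubini_integrable)
  show "(\<lambda>(x, y). f x * g y) \<in> borel_measurable (M1 \<Otimes>\<^sub>M M2)"
    using assms[THEN borel_measurable_integrable] by measurable
qed (use assms in \<open>auto simp: abs_mult\<close>)

text \<open>If \<open>f\<close> is not integrable, then neither is the integrand on the left, and both integrals are
  \<open>0\<close> by convention; this is why integrability of \<open>ln \<bar>F\<bar>\<close> is never needed.\<close>

lemma (in pair_sigma_finite) integral_sum_of_products:
  fixes f k u g :: "_ \<Rightarrow> real"
  assumes k: "integrable M1 k" and u: "integrable M2 u" "integral\<^sup>L M2 u = 1"
    and g: "integrable M2 g" "integral\<^sup>L M2 g = 0"
  shows "integral\<^sup>L (M1 \<Otimes>\<^sub>M M2) (\<lambda>(x, y). f x * u y + k x * g y) = integral\<^sup>L M1 f"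
proof -
  have kg: "integrable (M1 \<Otimes>\<^sub>M M2) (\<lambda>(x, y). k x * g y)"
    by (rule integrable_product) fact+
  show ?thesis
  proof (cases "integrable M1 f")
    case True
    then have fu: "integrable (M1 \<Otimes>\<^sub>M M2) (\<lambda>(x, y). f x * u y)"
      by (rule integrable_product) fact
    have "integral\<^sup>L (M1 \<Otimes>\<^sub>M M2) (\<lambda>(x, y). f x * u y + k x * g y) =
        integral\<^sup>L (M1 \<Otimes>\<^sub>M M2) (\<lambda>(x, y). f x * u y) + integral\<^sup>L (M1 \<Otimes>\<^sub>M M2) (\<lambda>(x, y). k x * g y)"
      using Bochner_Integration.integral_add[OF fu kg] by (simp add: case_prod_beta')
    also have "\<dots> = integral\<^sup>L M1 f"
      using integral_fst'[OF fu] integral_fst'[OF kg] u g by simp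
    finally show ?thesis .
  next
    case False
    have "\<not> integrable (M1 \<Otimes>\<^sub>M M2) (\<lambda>(x, y). f x * u y + k x * g y)"
    proof
      assume "integrable (M1 \<Otimes>\<^sub>M M2) (\<lambda>(x, y). f x * u y + k x * g y)"
      from Bochner_Integration.integrable_diff[OF this kg]
      have "integrable (M1 \<Otimes>\<^sub>M M2) (\<lambda>(x, y). f x * u y)"
        by (simp add: case_prod_beta')
      \<comment> \<open>Integrating out \<open>y\<close> multiplies \<open>f\<close> by the integral
        of \<open>u\<close>, which is 1, so \<open>f\<close> itself would be integrable.\<close>
      from integrable_fst'[OF this] show False
        using u False by simp
    qed
    with False show ?thesis by (simp add: not_integrable_integral_eq)
  qed
qed

text \<open>This allows one coordinate to be integrated separately. By uniqueness of the product
  measure it suffices to compare boxes, and the preimage of a box is again a box.\<close>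

lemma (in product_sigma_finite) distr_fun_upd:
  assumes "finite I" "i \<notin> I"
  shows "distr (PiM I M \<Otimes>\<^sub>M M i) (PiM (insert i I) M) (\<lambda>(x, y). x(i := y)) = PiM (insert i I) M"
proof (rule PiM_eqI)
  interpret I: finite_product_sigma_finite M I by standard fact
  fix A assume A: "\<And>j. j \<in> insert i I \<Longrightarrow> A j \<in> sets (M j)"
  have "(\<lambda>(x, y). x(i := y)) -` Pi\<^sub>E (insert i I) A \<inter> space (PiM I M \<Otimes>\<^sub>M M i) = Pi\<^sub>E I A \<times> A i"
    using A[THEN sets.sets_into_space] assms
    by (fastforce simp: space_PiM space_pair_measure PiE_iff extensional_def split: if_splits)
  moreover have "emeasure (PiM I M \<Otimes>\<^sub>M M i) (Pi\<^sub>E I A \<times> A i) = (\<Prod>j\<in>I. emeasure (M j) (A j)) * emeasure (M i) (A i)"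
    using A assms by (subst M.emeasure_pair_measure_Times) (auto simp: sets_PiM_I_finite I.measure_times)
  ultimately show "emeasure (distr (PiM I M \<Otimes>\<^sub>M M i) (PiM (insert i I) M) (\<lambda>(x, y). x(i := y)))
      (Pi\<^sub>E (insert i I) A) = (\<Prod>j\<in>insert i I. emeasure (M j) (A j))"
    using A assms by (subst emeasure_distr) (auto intro!: sets_PiM_I_finite measurable_add_dim simp: mult.commute)
qed (use assms in simp_all)

section \<open>Multiplication by z - 1 for a new variable z\<close>

lemma laurent_eval_mult_var_diff:
  assumes "\<And>i. z i \<noteq> 0"
  shows "laurent_eval (laurent_var l * F - F) z = (z l - 1) * laurent_eval F z"
proof -
  have "laurent_eval (laurent_var l * F) z = z l * laurent_eval F z"
    by (simp add: laurent_var_def laurent_eval_mult_single[OF assms] laurent_eval_single)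
  then show ?thesis
    using laurent_eval_add[of "laurent_var l * F - F" F z] by (simp add: algebra_simps)
qed

lemma laurent_in_vars_mult_var_diff:
  assumes "laurent_in_vars l F"
  shows "laurent_in_vars (Suc l) (laurent_var l * F - F)"
  unfolding laurent_in_vars_def
proof
  fix e assume e: "e \<in> Poly_Mapping.keys (laurent_var l * F - F)"
  have F: "Poly_Mapping.keys d \<subseteq> {..<Suc l}" if "d \<in> Poly_Mapping.keys F" for d
    using assms that unfolding laurent_in_vars_def by fastforce
  from e have "e \<in> Poly_Mapping.keys (laurent_var l * F) \<or> e \<in> Poly_Mapping.keys F"
    by (auto simp: in_keys_iff lookup_minus)
  then show "Poly_Mapping.keys e \<subseteq> {..<Suc l}"
  proof
    assume "e \<in> Poly_Mapping.keys (laurent_var l * F)"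
    then obtain d where d: "d \<in> Poly_Mapping.keys F" "e = Poly_Mapping.single l 1 + d"
      using keys_mult[of "laurent_var l" F] by (auto simp: laurent_var_def)
    then show ?thesis
      using F[OF d(1)] Poly_Mapping.keys_add[of "Poly_Mapping.single l 1" d] by auto
  qed (rule F)
qed

text \<open>Only coordinates below \<open>l\<close> are components of the product space, and the
  exponents of \<open>F\<close> involve no others.\<close>

lemma measurable_laurent_eval:
  assumes F: "laurent_in_vars l F" and w: "w \<in> borel_measurable borel"
  shows "(\<lambda>t. laurent_eval F (\<lambda>i. w (t i))) \<in> borel_measurable (\<Pi>\<^sub>M i\<in>{..<l}. (lborel :: real measure))"
  unfolding laurent_eval_def
proof (intro borel_measurable_sum borel_measurable_times borel_measurable_const borel_measurable_prod)
  fix e i assume "e \<in> Poly_Mapping.keys F" "i \<in> Poly_Mapping.keys e"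
  then have "i \<in> {..<l}"
    using F unfolding laurent_in_vars_def by blast
  then have "(\<lambda>t. t i) \<in> measurable (\<Pi>\<^sub>M i\<in>{..<l}. (lborel :: real measure)) lborel"
    by (rule measurable_component_singleton)
  with w have [measurable]: "(\<lambda>t. w (t i)) \<in> borel_measurable (\<Pi>\<^sub>M i\<in>{..<l}. (lborel :: real measure))"
    by (simp add: measurable_compose)
  show "(\<lambda>t. w (t i) powi Poly_Mapping.lookup e i) \<in> borel_measurable (\<Pi>\<^sub>M i\<in>{..<l}. (lborel :: real measure))"
    unfolding power_int_def by simp
qed

text \<open>With \<open>ln 0 = 0\<close>, the splitting \<open>ln \<bar>(z - 1) F\<bar> = ln \<bar>z - 1\<bar> + ln \<bar>F\<bar>\<close> fails where one factor
  vanishes.  The weight \<open>k\<close> (dropping the zeros of \<open>F\<close>) and the open interval in \<open>u\<close> (dropping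
  \<open>z = 1\<close>) make it hold everywhere.\<close>

lemma mahler_measure_mult_var_diff:
  assumes F: "laurent_in_vars l F"
  shows "mahler_measure (Suc l) (laurent_var l * F - F) = mahler_measure l F"
proof -
  let ?M = "\<lambda>_::nat. lborel :: real measure"
  define w where "w = (\<lambda>s::real. exp (2 * of_real pi * \<i> * of_real s))"
  have w: "w \<in> borel_measurable borel" "\<And>s. w s \<noteq> 0" by (simp_all add: w_def)
  define C where "C = (\<lambda>l::nat. {..<l} \<rightarrow>\<^sub>E {0..1::real})"
  define v where "v = (\<lambda>t. laurent_eval F (\<lambda>i. w (t i)))"
  define f where "f = (\<lambda>t. indicator (C l) t * ln (cmod (v t)))"
  define k where "k = (\<lambda>t. indicator (C l) t * (if v t = 0 then 0 else 1 :: real))"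
  define u where "u = (indicator {0<..<1} :: real \<Rightarrow> real)"
  define g where "g = (\<lambda>s::real. indicator {0..1} s * ln (2 * sin (pi * s)))"
  define H where "H = (\<lambda>t. indicator (C (Suc l)) t *
    ln (cmod (laurent_eval (laurent_var l * F - F) (\<lambda>i. w (t i)))))"
  interpret P: product_sigma_finite ?M by standard
  interpret I: finite_product_sigma_finite ?M "{..<l}" by standard simp
  interpret pair_sigma_finite "PiM {..<l} ?M" "lborel :: real measure" ..
  have C[measurable]: "C n \<in> sets (PiM {..<n} ?M)" for n
    unfolding C_def by (rule sets_PiM_I_finite) auto
  have v[measurable]: "v \<in> borel_measurable (PiM {..<l} ?M)"
    unfolding v_def by (rule measurable_laurent_eval[OF F w(1)])
  have H: "H \<in> borel_measurable (PiM {..<Suc l} ?M)"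
    using measurable_laurent_eval[OF laurent_in_vars_mult_var_diff[OF F] w(1)] C
    unfolding H_def by measurable
  have H_upd: "H (t(l := s)) = f t * u s + k t * g s" if t: "t \<in> space (PiM {..<l} ?M)" for t s
  proof -
    have "t(l := s) \<in> C (Suc l) \<longleftrightarrow> t \<in> C l \<and> s \<in> {0..1}"
      using t by (auto simp: C_def space_PiM PiE_iff extensional_def less_Suc_eq)
    then have ind: "indicator (C (Suc l)) (t(l := s)) = indicator (C l) t * (indicator {0..1} s :: real)"
      by (auto simp: indicator_def)
    \<comment> \<open>\<open>F\<close> does not involve the variable of index \<open>l\<close>, so
      the update is invisible to it.\<close>
    have "laurent_eval F (\<lambda>i. w ((t(l := s)) i)) = v t"
      unfolding v_def by (rule laurent_eval_cong[OF F]) simp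
    then have ev: "laurent_eval (laurent_var l * F - F) (\<lambda>i. w ((t(l := s)) i)) = (w s - 1) * v t"
      by (subst laurent_eval_mult_var_diff) (simp_all add: w)
    show ?thesis
    proof (cases "s \<in> {0..1}")
      case True
      then have n: "cmod (w s - 1) = 2 * sin (pi * s)"
        unfolding w_def by (rule norm_circle_minus_1)
      show ?thesis
      proof (cases "s = 0 \<or> s = 1")
        case True
        then have "2 * sin (pi * s) = 0" by auto
        then show ?thesis
          unfolding H_def ind ev norm_mult n using True by (auto simp: u_def g_def)
      next
        case False
        with True have s: "0 < s" "s < 1" by auto
        then have "sin (pi * s) > 0"
          by (intro sin_gt_zero) (auto simp: mult_less_cancel_left2 not_le)
        then show ?thesis
          unfolding H_def ind ev norm_mult n using s
          by (auto simp: u_def g_def f_def k_def ln_mult distrib_left)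
      qed
    qed (auto simp: H_def ind u_def g_def)
  qed
  \<comment> \<open>\<open>k\<close> is bounded by the indicator of the unit cube, which has finite
    measure.\<close>
  have k_int: "integrable (PiM {..<l} ?M) k"
  proof (rule Bochner_Integration.integrable_bound)
    show "integrable (PiM {..<l} ?M) (indicator (C l) :: _ \<Rightarrow> real)"
      using C[of l] by (simp add: C_def P.emeasure_PiM)
  qed (auto simp: k_def indicator_def)
  have u_int: "integrable lborel u" "integral\<^sup>L lborel u = 1"
    by (simp_all add: u_def)
  have g_int: "integrable lborel g" "integral\<^sup>L lborel g = 0"
    using integrable_ln_sin integral_ln_sin
    by (simp_all add: g_def set_integrable_def set_lebesgue_integral_def)
  have "mahler_measure (Suc l) (laurent_var l * F - F) = integral\<^sup>L (PiM {..<Suc l} ?M) H"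
    by (simp add: mahler_measure_def set_lebesgue_integral_def H_def C_def w_def)
  also have "\<dots> = integral\<^sup>L (distr (PiM {..<l} ?M \<Otimes>\<^sub>M lborel) (PiM {..<Suc l} ?M) (\<lambda>(x, y). x(l := y))) H"
    using P.distr_fun_upd[of "{..<l}" l] by (simp add: lessThan_Suc)
  also have "\<dots> = (\<integral>p. H ((\<lambda>(x, y). x(l := y)) p) \<partial>(PiM {..<l} ?M \<Otimes>\<^sub>M lborel))"
    using H measurable_add_dim[of l "{..<l}" ?M]
    by (intro integral_distr) (simp_all add: lessThan_Suc)
  also have "\<dots> = integral\<^sup>L (PiM {..<l} ?M \<Otimes>\<^sub>M lborel) (\<lambda>(x, y). f x * u y + k x * g y)"
    by (intro Bochner_Integration.integral_cong) (auto simp: space_pair_measure H_upd)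
  also have "\<dots> = integral\<^sup>L (PiM {..<l} ?M) f"
    by (rule integral_sum_of_products) fact+
  also have "\<dots> = mahler_measure l F"
    by (simp add: mahler_measure_def set_lebesgue_integral_def f_def C_def w_def v_def)
  finally show ?thesis .
qed

section \<open>The two inclusions combined\<close>

lemma integer_mahler_measure_in_mahler_set:
  assumes F: "laurent_in_vars l F" "integer_polynomial F" "F \<noteq> 0"
  shows "\<exists>n\<ge>1. mahler_measure l F \<in> mahler_set (2 * n) (alternating_form n)"
proof -
  let ?G = "laurent_var l * F - F"
  have "is_monomial_differences (Suc l) ?G"
    using F by (intro is_monomial_differences_mult_var) (auto simp: integer_polynomial_def)
  then obtain n p q where G: "?G = monomial_differences n p q"
    and pq: "\<forall>j. Poly_Mapping.keys (p j) \<subseteq> {..<Suc l}" "\<forall>j. Poly_Mapping.keys (q j) \<subseteq> {..<Suc l}"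
    unfolding is_monomial_differences_def by blast
  have ne: "monomial_differences n p q \<noteq> 0"
    using mult_var_diff_nonzero[OF F(1,3)] G by simp
  \<comment> \<open>The empty sum is 0, which nonvanishing excludes.\<close>
  have "n \<ge> 1"
  proof (rule ccontr)
    assume "\<not> n \<ge> 1"
    then have "n = 0" by simp
    with ne show False unfolding monomial_differences_def by simp
  qed
  moreover have "mahler_measure (Suc l) (monomial_differences n p q) \<in>
      mahler_set (2 * n) (alternating_form n)"
    unfolding mahler_set_alternating_form mem_Collect_eq
    by (intro exI[of _ "Suc l"] exI[of _ p] exI[of _ q] conjI refl pq ne)
  then have "mahler_measure l F \<in> mahler_set (2 * n) (alternating_form n)"
    using mahler_measure_mult_var_diff[OF F(1)] G by simp
  ultimately show ?thesis by blast
qed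

theorem proposition14:
  shows "integer_mahler_measures = (\<Union>n\<in>{1..}. mahler_set (2 * n) (alternating_form n))
    \<and> (\<forall>n\<ge>1. mahler_set (2 * n) (alternating_form n)
               \<subseteq> mahler_set (2 * (n + 1)) (alternating_form (n + 1)))"
proof (intro conjI allI impI mahler_set_alternating_form_mono)
  \<comment> \<open>This includes \<open>n = 0\<close>, where the set on the left is empty.\<close>
  have "mahler_set (2 * n) (alternating_form n) \<subseteq> integer_mahler_measures" for n
    unfolding mahler_set_alternating_form
    using monomial_differences_in_integer_mahler_measures by blast
  moreover have "integer_mahler_measures \<subseteq> (\<Union>n\<in>{1..}. mahler_set (2 * n) (alternating_form n))"
  proof
    fix x assume "x \<in> integer_mahler_measures"
    then obtain l F where "laurent_in_vars l F" "integer_polynomial F" "F \<noteq> 0"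
      and x: "x = mahler_measure l F"
      unfolding integer_mahler_measures_def by blast
    then obtain n where "n \<ge> 1" "x \<in> mahler_set (2 * n) (alternating_form n)"
      using integer_mahler_measure_in_mahler_set by blast
    then show "x \<in> (\<Union>n\<in>{1..}. mahler_set (2 * n) (alternating_form n))" by auto
  qed
  ultimately show "integer_mahler_measures = (\<Union>n\<in>{1..}. mahler_set (2 * n) (alternating_form n))"
    by blast
qed

end
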